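(* Let $d\ge 1$ and $\varphi\in GL(d,\mathbb{Z})$, and suppose that $G=\mathbb{Z}^d\rtimes_\varphi\mathbb{Z}$ has rank $2$. Then there are infinitely many Nielsen equivalence classes of generating pairs of $G$ if and only if the cyclic subgroup $\langle\varphi\rangle$ of $GL(d,\mathbb{Z})$ has infinite index in the centralizer of $\varphi$ in $GL(d,\mathbb{Z})$.
   Context: For a group $A$ and $\varphi\in \mathrm{Aut}(A)$, $A\rtimes_\varphi\mathbb{Z}=\langle A,t\mid tat^{-1}=\varphi(a)\ (a\in A)\rangle$. The rank of a finitely generated group is the minimum cardinality of a generating set. Two generating sets (tuples of the same length) of a group are Nielsen equivalent if one can pass from one to the other by finitely many Nielsen operations: permuting the generators, replacing a generator $g_i$ by $g_i^{-1}$, or replacing $g_i$ by $g_ig_j$ with $j\ne i$. *)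

theory Defs
  imports
    "HOL-Library.Multiset"
    "HOL-Analysis.Cartesian_Space"
    "HOL-Algebra.Bij"
    "HOL-Algebra.Coset"
    "HOL-Algebra.Generated_Groups"
begin

section \<open>The semidirect product of a group with the integers\<close>

text \<open>The pair \<open>(a, k)\<close> stands for \<open>a t^k\<close>, so \<open>A\<close> embeds as \<open>a \<mapsto> (a, 0)\<close> and the stable letter
  \<open>t\<close> is \<open>(1, 1)\<close>. The lemmas \<open>semidirect_Z_relation\<close> and \<open>semidirect_Z_universal\<close> below say that
  this is the group presented by \<open>\<langle>A, t | t a t^{-1} = \<phi>(a)\<rangle>\<close>.\<close>

definition semidirect_Z :: "('a, 'b) monoid_scheme \<Rightarrow> ('a \<Rightarrow> 'a) \<Rightarrow> ('a \<times> int) monoid" where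
  "semidirect_Z A \<phi> =
    \<lparr>carrier = carrier A \<times> UNIV,
     mult = (\<lambda>(a, k) (b, l). (a \<otimes>\<^bsub>A\<^esub> (\<phi> [^]\<^bsub>AutoGroup A\<^esub> k) b, k + l)),
     one = (\<one>\<^bsub>A\<^esub>, 0)\<rparr>"

locale group_aut = group A for A (structure) +
  fixes \<phi> :: "'a \<Rightarrow> 'a"
  assumes aut: "\<phi> \<in> carrier (AutoGroup A)"
begin

lemma pow_aut: "\<phi> [^]\<^bsub>AutoGroup A\<^esub> (k::int) \<in> auto A"
  using group.int_pow_closed[OF AutoGroup aut] by (simp add: AutoGroup_def)

lemma pow_closed [simp]: "x \<in> carrier A \<Longrightarrow> (\<phi> [^]\<^bsub>AutoGroup A\<^esub> (k::int)) x \<in> carrier A"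
  using pow_aut[of k] by (auto simp: auto_def hom_def)

lemma pow_mult:
  "x \<in> carrier A \<Longrightarrow> y \<in> carrier A \<Longrightarrow>
    (\<phi> [^]\<^bsub>AutoGroup A\<^esub> (k::int)) (x \<otimes> y) =
      (\<phi> [^]\<^bsub>AutoGroup A\<^esub> k) x \<otimes> (\<phi> [^]\<^bsub>AutoGroup A\<^esub> k) y"
  using pow_aut[of k] by (auto simp: auto_def hom_def)

lemma pow_one [simp]: "(\<phi> [^]\<^bsub>AutoGroup A\<^esub> (k::int)) \<one> = \<one>"
  using pow_aut[of k] by (metis IntD1 auto_def hom_one is_group)

lemma AutoGroup_one [simp]: "x \<in> carrier A \<Longrightarrow> \<one>\<^bsub>AutoGroup A\<^esub> x = x"
  by (simp add: AutoGroup_def BijGroup_def)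

lemma pow_0: "x \<in> carrier A \<Longrightarrow> (\<phi> [^]\<^bsub>AutoGroup A\<^esub> (0::int)) x = x"
  by (simp add: AutoGroup_def BijGroup_def)

lemma pow_1: "(\<phi> [^]\<^bsub>AutoGroup A\<^esub> (1::int)) x = \<phi> x"
  by (simp add: group.int_pow_1[OF AutoGroup aut])

lemma pow_add:
  assumes "x \<in> carrier A"
  shows "(\<phi> [^]\<^bsub>AutoGroup A\<^esub> (k + l :: int)) x =
    (\<phi> [^]\<^bsub>AutoGroup A\<^esub> k) ((\<phi> [^]\<^bsub>AutoGroup A\<^esub> l) x)"
proof -
  have "\<phi> [^]\<^bsub>AutoGroup A\<^esub> (k + l) =
      \<phi> [^]\<^bsub>AutoGroup A\<^esub> k \<otimes>\<^bsub>AutoGroup A\<^esub> \<phi> [^]\<^bsub>AutoGroup A\<^esub> l"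
    by (rule group.int_pow_mult[OF AutoGroup aut])
  also have "\<dots> = compose (carrier A) (\<phi> [^]\<^bsub>AutoGroup A\<^esub> k) (\<phi> [^]\<^bsub>AutoGroup A\<^esub> l)"
    using pow_aut[of k] pow_aut[of l] by (simp add: AutoGroup_def BijGroup_def auto_def)
  finally show ?thesis
    using assms by (simp add: compose_def)
qed

lemma semidirect_Z_simps [simp]:
  "carrier (semidirect_Z A \<phi>) = carrier A \<times> UNIV"
  "\<one>\<^bsub>semidirect_Z A \<phi>\<^esub> = (\<one>, 0)"
  "(a, k) \<otimes>\<^bsub>semidirect_Z A \<phi>\<^esub> (b, l) = (a \<otimes> (\<phi> [^]\<^bsub>AutoGroup A\<^esub> k) b, k + l)"
  by (simp_all add: semidirect_Z_def)

lemma group_semidirect_Z: "group (semidirect_Z A \<phi>)"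
proof (rule groupI)
  fix x y z
  assume "x \<in> carrier (semidirect_Z A \<phi>)" "y \<in> carrier (semidirect_Z A \<phi>)"
    "z \<in> carrier (semidirect_Z A \<phi>)"
  then show "x \<otimes>\<^bsub>semidirect_Z A \<phi>\<^esub> y \<otimes>\<^bsub>semidirect_Z A \<phi>\<^esub> z =
      x \<otimes>\<^bsub>semidirect_Z A \<phi>\<^esub> (y \<otimes>\<^bsub>semidirect_Z A \<phi>\<^esub> z)"
    by (cases x; cases y; cases z) (simp add: pow_mult pow_add m_assoc)
next
  fix x
  assume x: "x \<in> carrier (semidirect_Z A \<phi>)"
  obtain a k where [simp]: "x = (a, k)" by (cases x)
  have a: "a \<in> carrier A" using x by simp
  show "\<exists>y\<in>carrier (semidirect_Z A \<phi>). y \<otimes>\<^bsub>semidirect_Z A \<phi>\<^esub> x = \<one>\<^bsub>semidirect_Z A \<phi>\<^esub>"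
    by (rule bexI[of _ "(inv ((\<phi> [^]\<^bsub>AutoGroup A\<^esub> (- k)) a), - k)"]) (simp_all add: a l_inv)
qed (auto simp: pow_0)

lemma semidirect_Z_relation:
  assumes "a \<in> carrier A"
  shows "(\<one>, 1) \<otimes>\<^bsub>semidirect_Z A \<phi>\<^esub> (a, 0) \<otimes>\<^bsub>semidirect_Z A \<phi>\<^esub>
    inv\<^bsub>semidirect_Z A \<phi>\<^esub> (\<one>, 1) = (\<phi> a, 0)"
proof -
  interpret S: group "semidirect_Z A \<phi>" by (rule group_semidirect_Z)
  have "inv\<^bsub>semidirect_Z A \<phi>\<^esub> (\<one>, 1) = (\<one>, - 1)"
    by (rule S.inv_equality) simp_all
  moreover have "\<phi> a \<in> carrier A"
    using pow_closed[OF assms, of 1] by (simp add: pow_1)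
  ultimately show ?thesis
    by (simp add: pow_1)
qed

lemma semidirect_Z_embed:
  "(\<lambda>a. (a, 0)) \<in> hom A (semidirect_Z A \<phi>)"
  by (auto simp: hom_def pow_0)

lemma semidirect_Z_normal_form:
  assumes "a \<in> carrier A"
  shows "(a, 0) \<otimes>\<^bsub>semidirect_Z A \<phi>\<^esub> (\<one>, 1) [^]\<^bsub>semidirect_Z A \<phi>\<^esub> (k::int) = (a, k)"
proof -
  interpret S: group "semidirect_Z A \<phi>" by (rule group_semidirect_Z)
  have n: "(\<one>, 1) [^]\<^bsub>semidirect_Z A \<phi>\<^esub> (n::nat) = (\<one>, int n)" for n
    by (induction n) (simp_all add: S.nat_pow_Suc)
  have i: "inv\<^bsub>semidirect_Z A \<phi>\<^esub> (\<one>, l) = (\<one>, - l)" for l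
    by (rule S.inv_equality) simp_all
  have "(\<one>, 1) [^]\<^bsub>semidirect_Z A \<phi>\<^esub> k = (\<one>, k)"
    by (simp add: int_pow_def2 n i)
  then show ?thesis
    using assms by (simp add: pow_0)
qed

lemma semidirect_Z_universal:
  fixes H :: "('c, 'd) monoid_scheme"
  assumes H: "group H" and f: "f \<in> hom A H" and s: "s \<in> carrier H"
    and rel: "\<And>a. a \<in> carrier A \<Longrightarrow> s \<otimes>\<^bsub>H\<^esub> f a \<otimes>\<^bsub>H\<^esub> inv\<^bsub>H\<^esub> s = f (\<phi> a)"
  shows "\<exists>h \<in> hom (semidirect_Z A \<phi>) H. (\<forall>a\<in>carrier A. h (a, 0) = f a) \<and> h (\<one>, 1) = s"
    and "\<lbrakk>h \<in> hom (semidirect_Z A \<phi>) H; \<forall>a\<in>carrier A. h (a, 0) = f a; h (\<one>, 1) = s;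
      h' \<in> hom (semidirect_Z A \<phi>) H; \<forall>a\<in>carrier A. h' (a, 0) = f a; h' (\<one>, 1) = s;
      x \<in> carrier (semidirect_Z A \<phi>)\<rbrakk> \<Longrightarrow> h x = h' x"
proof -
  interpret H: group H by (rule H)
  have fc [simp]: "f a \<in> carrier H" if "a \<in> carrier A" for a
    using f that by (auto simp: hom_def)
  have \<phi>c: "\<phi> a \<in> carrier A" if "a \<in> carrier A" for a
    using pow_closed[OF that, of 1] by (simp add: pow_1)
  have step: "s \<otimes>\<^bsub>H\<^esub> f a = f (\<phi> a) \<otimes>\<^bsub>H\<^esub> s" if "a \<in> carrier A" for a
    using rel[OF that] that s by (metis H.inv_solve_right' H.m_closed \<phi>c fc)
  have swap: "s [^]\<^bsub>H\<^esub> k \<otimes>\<^bsub>H\<^esub> f a = f ((\<phi> [^]\<^bsub>AutoGroup A\<^esub> k) a) \<otimes>\<^bsub>H\<^esub> s [^]\<^bsub>H\<^esub> k"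
    if "a \<in> carrier A" for a and k :: int
    using that
  proof (induction k arbitrary: a rule: int_induct[where k = 0])
    case base
    then show ?case by (simp add: pow_0)
  next
    case (step1 i)
    have *: "s [^]\<^bsub>H\<^esub> (i + 1) = s [^]\<^bsub>H\<^esub> i \<otimes>\<^bsub>H\<^esub> s"
      using s by (simp add: H.int_pow_mult)
    have "s [^]\<^bsub>H\<^esub> (i + 1) \<otimes>\<^bsub>H\<^esub> f a = s [^]\<^bsub>H\<^esub> i \<otimes>\<^bsub>H\<^esub> f (\<phi> a) \<otimes>\<^bsub>H\<^esub> s"
      using step1.prems s step[of a] \<phi>c by (simp add: * H.m_assoc)
    also have "\<dots> = f ((\<phi> [^]\<^bsub>AutoGroup A\<^esub> i) (\<phi> a)) \<otimes>\<^bsub>H\<^esub> s [^]\<^bsub>H\<^esub> (i + 1)"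
      using step1 s \<phi>c by (simp add: * H.m_assoc[symmetric])
    finally show ?case
      using step1 by (simp add: pow_add pow_1)
  next
    case (step2 i)
    let ?b = "(\<phi> [^]\<^bsub>AutoGroup A\<^esub> (- 1 :: int)) a"
    have b: "?b \<in> carrier A" "\<phi> ?b = a"
      using step2 pow_add[of a 1 "- 1"] by (simp_all add: pow_0 pow_1)
    have *: "s [^]\<^bsub>H\<^esub> i = s [^]\<^bsub>H\<^esub> (i - 1) \<otimes>\<^bsub>H\<^esub> s"
      using s H.int_pow_mult[of s "i - 1" 1] by simp
    have "s [^]\<^bsub>H\<^esub> (i - 1) \<otimes>\<^bsub>H\<^esub> f a \<otimes>\<^bsub>H\<^esub> s = s [^]\<^bsub>H\<^esub> i \<otimes>\<^bsub>H\<^esub> f ?b"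
      using step2 s step[of ?b] b by (simp add: * H.m_assoc)
    also have "\<dots> = f ((\<phi> [^]\<^bsub>AutoGroup A\<^esub> i) ?b) \<otimes>\<^bsub>H\<^esub> s [^]\<^bsub>H\<^esub> i"
      using step2.IH b by simp
    also have "\<dots> = f ((\<phi> [^]\<^bsub>AutoGroup A\<^esub> (i - 1)) a) \<otimes>\<^bsub>H\<^esub> s [^]\<^bsub>H\<^esub> (i - 1) \<otimes>\<^bsub>H\<^esub> s"
      using step2 s pow_add[of a i "- 1"] by (simp add: * H.m_assoc)
    finally show ?case
      using step2 s by simp
  qed
  let ?h = "\<lambda>(a, k). f a \<otimes>\<^bsub>H\<^esub> s [^]\<^bsub>H\<^esub> (k::int)"
  have "?h \<in> hom (semidirect_Z A \<phi>) H"
  proof (rule homI)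
    fix x y
    assume xy: "x \<in> carrier (semidirect_Z A \<phi>)" "y \<in> carrier (semidirect_Z A \<phi>)"
    obtain a k b l where [simp]: "x = (a, k)" "y = (b, l)" by (cases x, cases y)
    have ab: "a \<in> carrier A" "b \<in> carrier A" using xy by simp_all
    let ?b = "(\<phi> [^]\<^bsub>AutoGroup A\<^esub> k) b"
    have "?h (x \<otimes>\<^bsub>semidirect_Z A \<phi>\<^esub> y) =
        f a \<otimes>\<^bsub>H\<^esub> (f ?b \<otimes>\<^bsub>H\<^esub> s [^]\<^bsub>H\<^esub> k) \<otimes>\<^bsub>H\<^esub> s [^]\<^bsub>H\<^esub> l"
      using ab s hom_mult[OF f, of a ?b] by (simp add: H.int_pow_mult H.m_assoc)
    also have "\<dots> = f a \<otimes>\<^bsub>H\<^esub> (s [^]\<^bsub>H\<^esub> k \<otimes>\<^bsub>H\<^esub> f b) \<otimes>\<^bsub>H\<^esub> s [^]\<^bsub>H\<^esub> l"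
      using swap[OF ab(2), of k] by simp
    also have "\<dots> = ?h x \<otimes>\<^bsub>H\<^esub> ?h y"
      using ab s by (simp add: H.m_assoc)
    finally show "?h (x \<otimes>\<^bsub>semidirect_Z A \<phi>\<^esub> y) = ?h x \<otimes>\<^bsub>H\<^esub> ?h y" .
  qed (use s in auto)
  moreover have "?h (\<one>, 1) = s"
    using s hom_one[OF f is_group H] by simp
  ultimately show "\<exists>h \<in> hom (semidirect_Z A \<phi>) H. (\<forall>a\<in>carrier A. h (a, 0) = f a) \<and> h (\<one>, 1) = s"
    by (intro bexI[of _ ?h]) auto
  have val: "g (a, k) = f a \<otimes>\<^bsub>H\<^esub> s [^]\<^bsub>H\<^esub> k"
    if "g \<in> hom (semidirect_Z A \<phi>) H" "\<forall>a\<in>carrier A. g (a, 0) = f a" "g (\<one>, 1) = s"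
      "a \<in> carrier A" for g a and k :: int
  proof -
    interpret S: group "semidirect_Z A \<phi>" by (rule group_semidirect_Z)
    have t: "(\<one>, 1) \<in> carrier (semidirect_Z A \<phi>)" by simp
    have "g (a, k) = g ((a, 0) \<otimes>\<^bsub>semidirect_Z A \<phi>\<^esub> (\<one>, 1) [^]\<^bsub>semidirect_Z A \<phi>\<^esub> k)"
      by (simp only: semidirect_Z_normal_form[OF that(4)])
    also have "\<dots> = g (a, 0) \<otimes>\<^bsub>H\<^esub> g ((\<one>, 1) [^]\<^bsub>semidirect_Z A \<phi>\<^esub> k)"
      by (rule hom_mult[OF that(1)])
        (use that(4) S.int_pow_closed[OF t] in \<open>simp_all del: S.int_pow_closed\<close>)
    also have "g ((\<one>, 1) [^]\<^bsub>semidirect_Z A \<phi>\<^esub> k) = s [^]\<^bsub>H\<^esub> k"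
      using hom_int_pow[OF that(1) t group_semidirect_Z H] that(3) by simp
    finally show ?thesis using that by simp
  qed
  show "h x = h' x"
    if "h \<in> hom (semidirect_Z A \<phi>) H" "\<forall>a\<in>carrier A. h (a, 0) = f a" "h (\<one>, 1) = s"
      "h' \<in> hom (semidirect_Z A \<phi>) H" "\<forall>a\<in>carrier A. h' (a, 0) = f a" "h' (\<one>, 1) = s"
      "x \<in> carrier (semidirect_Z A \<phi>)"
    using val[OF that(1-3)] val[OF that(4-6)] that(7) by (cases x) simp
qed

end


section \<open>Integer vectors and matrices\<close>

text \<open>The dimension \<open>d \<ge> 1\<close> is the cardinality of the finite index type \<open>'n\<close>.\<close>

definition Zd :: "(int ^ 'n) monoid" where
  "Zd = \<lparr>carrier = UNIV, mult = (+), one = 0\<rparr>"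

definition GL_int :: "(int ^ 'n ^ 'n) monoid" where
  "GL_int = \<lparr>carrier = {M. invertible M}, mult = (**), one = mat 1\<rparr>"

definition Zd_by_Z :: "int ^ 'n ^ 'n \<Rightarrow> ((int ^ 'n) \<times> int) monoid" where
  "Zd_by_Z \<phi> = semidirect_Z Zd (\<lambda>v. \<phi> *v v)"

lemma group_Zd: "group Zd"
proof (rule groupI)
  fix x :: "int ^ 'n"
  show "\<exists>y\<in>carrier Zd. y \<otimes>\<^bsub>Zd\<^esub> x = \<one>\<^bsub>Zd\<^esub>"
    by (rule bexI[of _ "- x"]) (simp_all add: Zd_def)
qed (simp_all add: Zd_def)

lemma group_GL_int: "group GL_int"
proof (rule groupI)
  fix x y :: "int ^ 'n ^ 'n"
  assume "x \<in> carrier GL_int" "y \<in> carrier GL_int"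
  then obtain x' y' where
    x: "x ** x' = mat 1" "x' ** x = mat 1" and y: "y ** y' = mat 1" "y' ** y = mat 1"
    by (auto simp: GL_int_def invertible_def)
  have "(x ** y) ** (y' ** x') = mat 1" "(y' ** x') ** (x ** y) = mat 1"
    using x y by (metis matrix_mul_assoc matrix_mul_rid)+
  then show "x \<otimes>\<^bsub>GL_int\<^esub> y \<in> carrier GL_int"
    by (auto simp: GL_int_def invertible_def)
next
  show "\<one>\<^bsub>GL_int\<^esub> \<in> carrier (GL_int :: (int ^ 'n ^ 'n) monoid)"
    by (auto simp: GL_int_def invertible_def intro!: exI[of _ "mat 1"])
qed (auto simp: GL_int_def invertible_def matrix_mul_assoc)

lemma GL_int_aut: "\<phi> \<in> carrier GL_int \<Longrightarrow> (\<lambda>v. \<phi> *v v) \<in> carrier (AutoGroup Zd)"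
proof -
  assume "\<phi> \<in> carrier GL_int"
  then obtain \<psi> where \<psi>: "\<phi> ** \<psi> = mat 1" "\<psi> ** \<phi> = mat 1"
    by (auto simp: GL_int_def invertible_def)
  have "bij (\<lambda>v. \<phi> *v v)"
    by (rule bij_betw_byWitness[where f' = "\<lambda>v. \<psi> *v v"])
      (simp_all add: matrix_vector_mul_assoc \<psi>)
  then show ?thesis
    by (simp add: AutoGroup_def auto_def Bij_def Zd_def hom_def matrix_vector_right_distrib)
qed

lemma group_Zd_by_Z: "\<phi> \<in> carrier GL_int \<Longrightarrow> group (Zd_by_Z \<phi>)"
  unfolding Zd_by_Z_def
  by (intro group_aut.group_semidirect_Z group_aut.intro group_Zd group_aut_axioms.intro GL_int_aut)


section \<open>Rank, centralizers and Nielsen equivalence\<close>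

text \<open>\<open>has_rank G n\<close> includes that \<open>G\<close> is finitely generated.\<close>

definition has_rank :: "('a, 'b) monoid_scheme \<Rightarrow> nat \<Rightarrow> bool" where
  "has_rank G n \<longleftrightarrow>
    (\<exists>S \<subseteq> carrier G. finite S \<and> generate G S = carrier G \<and> card S = n) \<and>
    (\<forall>S \<subseteq> carrier G. finite S \<and> generate G S = carrier G \<longrightarrow> n \<le> card S)"

definition centralizer :: "('a, 'b) monoid_scheme \<Rightarrow> 'a \<Rightarrow> 'a set" where
  "centralizer G x = {y \<in> carrier G. x \<otimes>\<^bsub>G\<^esub> y = y \<otimes>\<^bsub>G\<^esub> x}"

definition infinite_index :: "('a, 'b) monoid_scheme \<Rightarrow> 'a set \<Rightarrow> 'a set \<Rightarrow> bool" where
  "infinite_index G K H \<longleftrightarrow> infinite (rcosets\<^bsub>G\<lparr>carrier := K\<rparr>\<^esub> H)"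

definition generating_tuples :: "('a, 'b) monoid_scheme \<Rightarrow> nat \<Rightarrow> 'a list set" where
  "generating_tuples G n =
    {xs. length xs = n \<and> set xs \<subseteq> carrier G \<and> generate G (set xs) = carrier G}"

inductive nielsen_step :: "('a, 'b) monoid_scheme \<Rightarrow> 'a list \<Rightarrow> 'a list \<Rightarrow> bool"
  for G :: "('a, 'b) monoid_scheme" where
  permute: "mset ys = mset xs \<Longrightarrow> nielsen_step G xs ys"
| invert: "i < length xs \<Longrightarrow> nielsen_step G xs (xs[i := inv\<^bsub>G\<^esub> (xs ! i)])"
| multiply: "\<lbrakk>i < length xs; j < length xs; j \<noteq> i\<rbrakk> \<Longrightarrow>
    nielsen_step G xs (xs[i := xs ! i \<otimes>\<^bsub>G\<^esub> xs ! j])"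

definition nielsen_equiv :: "('a, 'b) monoid_scheme \<Rightarrow> nat \<Rightarrow> ('a list \<times> 'a list) set" where
  "nielsen_equiv G n =
    {(xs, ys). xs \<in> generating_tuples G n \<and> ys \<in> generating_tuples G n \<and>
      (nielsen_step G)\<^sup>*\<^sup>* xs ys}"

definition nielsen_classes :: "('a, 'b) monoid_scheme \<Rightarrow> nat \<Rightarrow> 'a list set set" where
  "nielsen_classes G n = generating_tuples G n // nielsen_equiv G n"

lemma subgroup_centralizer:
  assumes "group G" "x \<in> carrier G"
  shows "subgroup (centralizer G x) G"
proof -
  interpret group G by fact
  show ?thesis
  proof (rule subgroupI)
    show "centralizer G x \<noteq> {}"
      using assms(2) by (auto simp: centralizer_def)
  next
    fix a assume "a \<in> centralizer G x"
    then have "a \<in> carrier G" "x \<otimes>\<^bsub>G\<^esub> a = a \<otimes>\<^bsub>G\<^esub> x" by (auto simp: centralizer_def)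
    then have "x \<otimes>\<^bsub>G\<^esub> inv\<^bsub>G\<^esub> a = inv\<^bsub>G\<^esub> a \<otimes>\<^bsub>G\<^esub> x"
      using assms(2) by (metis inv_closed inv_solve_left inv_solve_right m_assoc m_closed)
    then show "inv\<^bsub>G\<^esub> a \<in> centralizer G x"
      using \<open>a \<in> carrier G\<close> by (simp add: centralizer_def)
  next
    fix a b assume "a \<in> centralizer G x" "b \<in> centralizer G x"
    then show "a \<otimes>\<^bsub>G\<^esub> b \<in> centralizer G x"
      using assms(2) by (simp add: centralizer_def) (metis m_assoc)
  qed (auto simp: centralizer_def)
qed

lemma nielsen_step_carrier:
  assumes "group G" "nielsen_step G xs ys" "set xs \<subseteq> carrier G"
  shows "set ys \<subseteq> carrier G"
  using assms(2,3)
proof cases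
  case permute
  then show ?thesis using assms(3) by (metis set_mset_mset)
next
  case (invert i)
  have "xs ! i \<in> carrier G" using invert assms(3) by auto
  then have "inv\<^bsub>G\<^esub> (xs ! i) \<in> carrier G" using assms(1) by (simp add: group.inv_closed)
  then show ?thesis
    using invert(1) assms(3) set_update_subset_insert[of xs i "inv\<^bsub>G\<^esub> (xs ! i)"] by auto
next
  case (multiply i j)
  have "xs ! i \<in> carrier G" "xs ! j \<in> carrier G" using multiply assms(3) by auto
  then have "xs ! i \<otimes>\<^bsub>G\<^esub> xs ! j \<in> carrier G"
    using assms(1) by (simp add: group.is_monoid monoid.m_closed)
  then show ?thesis
    using multiply(1) assms(3) set_update_subset_insert[of xs i "xs ! i \<otimes>\<^bsub>G\<^esub> xs ! j"] by auto
qed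

lemma nielsen_step_sym:
  assumes "group G" "nielsen_step G xs ys" "set xs \<subseteq> carrier G"
  shows "(nielsen_step G)\<^sup>*\<^sup>* ys xs"
proof -
  interpret group G by fact
  show ?thesis
    using assms(2)
  proof cases
    case permute
    then show ?thesis by (intro r_into_rtranclp nielsen_step.permute) simp
  next
    case (invert i)
    have "xs ! i \<in> carrier G" using invert assms(3) by auto
    then show ?thesis
      using nielsen_step.invert[of i ys G] invert by auto
  next
    case (multiply i j)
    have c: "xs ! i \<in> carrier G" "xs ! j \<in> carrier G" using multiply assms(3) by auto
    let ?a = "ys[j := inv\<^bsub>G\<^esub> (ys ! j)]"
    let ?b = "?a[i := ?a ! i \<otimes>\<^bsub>G\<^esub> ?a ! j]"
    let ?c = "?b[j := inv\<^bsub>G\<^esub> (?b ! j)]"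
    have "nielsen_step G ys ?a" "nielsen_step G ?a ?b" "nielsen_step G ?b ?c"
      using multiply by (intro nielsen_step.intros; simp)+
    then have "(nielsen_step G)\<^sup>*\<^sup>* ys ?c" by (meson r_into_rtranclp rtranclp_trans)
    moreover have "?c = xs"
      using multiply c by (intro nth_equalityI) (auto simp: nth_list_update m_assoc)
    ultimately show ?thesis by simp
  qed
qed

lemma equiv_nielsen:
  assumes "group G"
  shows "equiv (generating_tuples G n) (nielsen_equiv G n)"
proof (rule equivI)
  have sym: "(nielsen_step G)\<^sup>*\<^sup>* ys xs \<and> set ys \<subseteq> carrier G"
    if "(nielsen_step G)\<^sup>*\<^sup>* xs ys" "set xs \<subseteq> carrier G" for xs ys
    using that
  proof (induction rule: rtranclp_induct)
    case (step y z)
    then show ?case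
      using nielsen_step_sym[OF assms step(2)] nielsen_step_carrier[OF assms step(2)]
      by (auto intro: rtranclp_trans)
  qed simp
  show "sym (nielsen_equiv G n)"
    using sym by (auto simp: sym_def nielsen_equiv_def generating_tuples_def)
qed (auto simp: nielsen_equiv_def refl_on_def trans_def intro: rtranclp_trans)

end

theory Submission
  imports Defs
begin

text \<open>By the Euclidean algorithm on the \<open>\<int>\<close>-components, every generating pair is Nielsen
  equivalent to some \<open>(a, t)\<close> where \<open>a\<close> generates \<open>\<int>\<^sup>d\<close> as a \<open>\<int>[\<phi>, \<phi>\<inverse>]\<close>-module. Nielsen moves
  preserve the commutator of a pair up to inversion and conjugation; for \<open>(a, t)\<close> it is
  \<open>(1 - \<phi>) a\<close>. Since \<open>1 - \<phi>\<close> need not be injective, the formal quotient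
  \<open>[l] v - [k] w\<close> with \<open>[k] = (1 - \<phi>^k) / (1 - \<phi>)\<close> is attached to the pair \<open>(v t^k, w t^l)\<close>
  instead. It is invariant up to \<open>\<plusminus>\<phi>^i\<close> and equals \<open>a\<close> on \<open>(a, t)\<close>, so the Nielsen classes
  are the orbits of \<open>\<plusminus>\<langle>\<phi>\<rangle>\<close> on the cyclic vectors. The centralizer of \<open>\<phi>\<close> acts simply
  transitively on the cyclic vectors, and \<open>\<langle>\<phi>\<rangle>\<close> has index at most two in \<open>\<plusminus>\<langle>\<phi>\<rangle>\<close>.\<close>

section \<open>Nielsen moves preserve the generated subgroup\<close>

lemma (in group) nielsen_step_generate_subset:
  assumes "nielsen_step G xs ys" "set xs \<subseteq> carrier G"
  shows "generate G (set ys) \<subseteq> generate G (set xs)"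
proof (rule generate_subgroup_incl[OF _ generate_is_subgroup[OF assms(2)]])
  show "set ys \<subseteq> generate G (set xs)"
    using assms(1)
  proof cases
    case permute
    then show ?thesis
      by (metis generate.incl set_mset_mset subsetI)
  next
    case (invert i)
    then have "inv (xs ! i) \<in> generate G (set xs)"
      by (intro generate.inv) simp
    then show ?thesis
      using invert set_update_subset_insert[of xs i "inv (xs ! i)"] by (auto intro: generate.incl)
  next
    case (multiply i j)
    then have "xs ! i \<otimes> xs ! j \<in> generate G (set xs)"
      by (intro generate.eng generate.incl) simp_all
    then show ?thesis
      using multiply set_update_subset_insert[of xs i "xs ! i \<otimes> xs ! j"]
      by (auto intro: generate.incl)
  qed
qed

lemma (in group) nielsen_steps_generate_subset:
  assumes "(nielsen_step G)\<^sup>*\<^sup>* xs ys" "set xs \<subseteq> carrier G"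
  shows "set ys \<subseteq> carrier G \<and> generate G (set ys) \<subseteq> generate G (set xs)"
  using assms
proof (induction rule: rtranclp_induct)
  case (step y z)
  then show ?case
    using nielsen_step_generate_subset[of y z] nielsen_step_carrier[OF is_group, of y z] by auto
qed simp

lemma (in group) nielsen_steps_sym:
  assumes "(nielsen_step G)\<^sup>*\<^sup>* xs ys" "set xs \<subseteq> carrier G"
  shows "(nielsen_step G)\<^sup>*\<^sup>* ys xs"
  using assms
proof (induction rule: rtranclp_induct)
  case (step y z)
  have "set y \<subseteq> carrier G"
    using nielsen_steps_generate_subset[OF step.hyps(1) step.prems] by simp
  then show ?case
    using nielsen_step_sym[OF is_group step.hyps(2)] step.IH step.prems by (meson rtranclp_trans)
qed simp

text \<open>Moves are reversible, so the one-sided inclusion can be applied in both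
  directions.\<close>

lemma (in group) nielsen_steps_generate_eq:
  assumes "(nielsen_step G)\<^sup>*\<^sup>* xs ys" "set xs \<subseteq> carrier G"
  shows "generate G (set ys) = generate G (set xs)"
  using nielsen_steps_generate_subset[OF assms]
    nielsen_steps_generate_subset[OF nielsen_steps_sym[OF assms]] by blast

lemma nielsen_steps_pair:
  shows nielsen_swap: "(nielsen_step G)\<^sup>*\<^sup>* [x, y] [y, x]"
    and nielsen_inv1: "(nielsen_step G)\<^sup>*\<^sup>* [x, y] [inv\<^bsub>G\<^esub> x, y]"
    and nielsen_inv2: "(nielsen_step G)\<^sup>*\<^sup>* [x, y] [x, inv\<^bsub>G\<^esub> y]"
    and nielsen_mult1: "(nielsen_step G)\<^sup>*\<^sup>* [x, y] [x \<otimes>\<^bsub>G\<^esub> y, y]"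
    and nielsen_mult2: "(nielsen_step G)\<^sup>*\<^sup>* [x, y] [x, y \<otimes>\<^bsub>G\<^esub> x]"
proof -
  show "(nielsen_step G)\<^sup>*\<^sup>* [x, y] [y, x]"
    by (intro r_into_rtranclp nielsen_step.permute) simp
  show "(nielsen_step G)\<^sup>*\<^sup>* [x, y] [inv\<^bsub>G\<^esub> x, y]"
    using nielsen_step.invert[of 0 "[x, y]" G] by (simp add: r_into_rtranclp)
  show "(nielsen_step G)\<^sup>*\<^sup>* [x, y] [x, inv\<^bsub>G\<^esub> y]"
    using nielsen_step.invert[of 1 "[x, y]" G] by (simp add: r_into_rtranclp)
  show "(nielsen_step G)\<^sup>*\<^sup>* [x, y] [x \<otimes>\<^bsub>G\<^esub> y, y]"
    using nielsen_step.multiply[of 0 "[x, y]" 1 G] by (simp add: r_into_rtranclp)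
  show "(nielsen_step G)\<^sup>*\<^sup>* [x, y] [x, y \<otimes>\<^bsub>G\<^esub> x]"
    using nielsen_step.multiply[of 1 "[x, y]" 0 G] by (simp add: r_into_rtranclp)
qed

lemma nielsen_step_pair_cases:
  assumes "nielsen_step G [x, y] zs"
  obtains "zs = [x, y]" | "zs = [y, x]" | "zs = [inv\<^bsub>G\<^esub> x, y]" | "zs = [x, inv\<^bsub>G\<^esub> y]"
    | "zs = [x \<otimes>\<^bsub>G\<^esub> y, y]" | "zs = [x, y \<otimes>\<^bsub>G\<^esub> x]"
  using assms
proof cases
  case permute
  then have "length zs = 2"
    by (metis length_Cons list.size(3) numeral_2_eq_2 size_mset)
  then obtain a b where "zs = [a, b]"
    by (auto simp: length_Suc_conv numeral_2_eq_2)
  with permute that(1,2) show ?thesis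
    by (auto simp: add_eq_conv_ex)
next
  case (invert i)
  then have "i = 0 \<or> i = 1" by auto
  with invert that(3,4) show ?thesis by auto
next
  case (multiply i j)
  then have "(i = 0 \<and> j = 1) \<or> (i = 1 \<and> j = 0)" by auto
  with multiply that(5,6) show ?thesis by auto
qed

section \<open>Laurent polynomials in \<phi>, brackets and orbits\<close>

lemma matrix_vector_mult_minus_left: "(- A) *v x = - (A *v x)"
  for A :: "'a::ring_1 ^ 'n ^ 'm"
  using matrix_vector_mult_diff_rdistrib[of 0 A x] by simp

lemma matrix_vector_mult_minus_right: "A *v (- x) = - (A *v x)"
  for A :: "'a::ring_1 ^ 'n ^ 'm"
  using matrix_vector_mult_diff_distrib[of A 0 x] by simp

abbreviation mpow :: "int ^ 'n ^ 'n \<Rightarrow> int \<Rightarrow> int ^ 'n ^ 'n" where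
  "mpow \<phi> k \<equiv> \<phi> [^]\<^bsub>GL_int\<^esub> k"

text \<open>This is the ring \<open>\<int>[\<phi>, \<phi>\<inverse>]\<close> of matrices. Closure
  under differences already gives zero, negatives and sums.\<close>

inductive_set laurent :: "int ^ 'n ^ 'n \<Rightarrow> (int ^ 'n ^ 'n) set" for \<phi> where
  one: "mat 1 \<in> laurent \<phi>"
| pow: "P \<in> laurent \<phi> \<Longrightarrow> mpow \<phi> k ** P \<in> laurent \<phi>"
| diff: "P \<in> laurent \<phi> \<Longrightarrow> Q \<in> laurent \<phi> \<Longrightarrow> P - Q \<in> laurent \<phi>"

definition cyclic_vector :: "int ^ 'n ^ 'n \<Rightarrow> int ^ 'n \<Rightarrow> bool" where
  "cyclic_vector \<phi> a \<longleftrightarrow> (\<forall>v. \<exists>P \<in> laurent \<phi>. v = P *v a)"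

text \<open>The value \<open>[k] v\<close> of the formal quotient \<open>(1 - \<phi>^k) / (1 - \<phi>)\<close>, also for negative \<open>k\<close>.\<close>

definition bracket :: "int ^ 'n ^ 'n \<Rightarrow> int \<Rightarrow> int ^ 'n \<Rightarrow> int ^ 'n" where
  "bracket \<phi> k v =
    (if k \<ge> 0 then \<Sum>i\<in>{0..<k}. mpow \<phi> i *v v else - (\<Sum>i\<in>{k..<0}. mpow \<phi> i *v v))"

text \<open>The commutator of \<open>(v, k)\<close> and \<open>(w, l)\<close> has first component
  \<open>(1 - \<phi>^l) v - (1 - \<phi>^k) w\<close>; dividing it formally by
  \<open>1 - \<phi>\<close> gives this expression.\<close>

fun comm_quotient :: "int ^ 'n ^ 'n \<Rightarrow> ((int ^ 'n) \<times> int) list \<Rightarrow> int ^ 'n" where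
  "comm_quotient \<phi> [(v, k), (w, l)] = bracket \<phi> l v - bracket \<phi> k w"
| "comm_quotient \<phi> _ = 0"

definition same_orbit :: "int ^ 'n ^ 'n \<Rightarrow> int ^ 'n \<Rightarrow> int ^ 'n \<Rightarrow> bool" where
  "same_orbit \<phi> u v \<longleftrightarrow> (\<exists>k. v = mpow \<phi> k *v u \<or> v = - (mpow \<phi> k *v u))"

section \<open>The semidirect product in matrix coordinates\<close>

locale GL_int_elem =
  fixes \<phi> :: "int ^ 'n ^ 'n"
  assumes GL: "\<phi> \<in> carrier GL_int"
begin

abbreviation "S \<equiv> Zd_by_Z \<phi>"
abbreviation "N \<equiv> (nielsen_step S)\<^sup>*\<^sup>*"

sublocale L: group "GL_int :: (int ^ 'n ^ 'n) monoid" by (rule group_GL_int)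
sublocale S: group S by (rule group_Zd_by_Z[OF GL])

lemma GL_mult: "A \<otimes>\<^bsub>GL_int\<^esub> B = A ** B" for A B :: "int ^ 'n ^ 'n"
  by (simp add: GL_int_def)

lemma GL_one [simp]: "\<one>\<^bsub>GL_int\<^esub> = (mat 1 :: int ^ 'n ^ 'n)"
  by (simp add: GL_int_def)

lemma mpow_1 [simp]: "mpow \<phi> 1 = \<phi>"
  by (simp add: L.int_pow_1[OF GL])

lemma mpow_add: "mpow \<phi> (k + l) = mpow \<phi> k ** mpow \<phi> l"
  using L.int_pow_mult[OF GL, of k l] by (simp add: GL_mult)

lemma mpow_mpow_apply [simp]: "mpow \<phi> k *v (mpow \<phi> l *v v) = mpow \<phi> (k + l) *v v"
  by (simp add: mpow_add matrix_vector_mul_assoc)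

text \<open>Sending a matrix to its action on vectors is a group homomorphism from
  \<open>GL_int\<close> to \<open>AutoGroup Zd\<close>, hence compatible with integer
  powers.\<close>

lemma aut_pow: "((\<lambda>v. \<phi> *v v) [^]\<^bsub>AutoGroup Zd\<^esub> k) v = mpow \<phi> k *v v" for k :: int
proof -
  have "(\<lambda>A v. A *v v) \<in> hom (GL_int :: (int ^ 'n ^ 'n) monoid) (AutoGroup Zd)"
  proof (rule homI)
    fix A B :: "int ^ 'n ^ 'n"
    assume AB: "A \<in> carrier GL_int" "B \<in> carrier GL_int"
    show "(\<lambda>v. (A \<otimes>\<^bsub>GL_int\<^esub> B) *v v) = (\<lambda>v. A *v v) \<otimes>\<^bsub>AutoGroup Zd\<^esub> (\<lambda>v. B *v v)"
      using GL_int_aut[OF AB(1)] GL_int_aut[OF AB(2)]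
      by (simp add: AutoGroup_def BijGroup_def auto_def compose_def GL_mult
          matrix_vector_mul_assoc Zd_def restrict_def)
  qed (rule GL_int_aut)
  from hom_int_pow[OF this GL group_GL_int group.AutoGroup[OF group_Zd]]
  have "(\<lambda>v. mpow \<phi> k *v v) = (\<lambda>v. \<phi> *v v) [^]\<^bsub>AutoGroup Zd\<^esub> k" .
  then show ?thesis by metis
qed

sublocale A: group_aut "Zd :: (int ^ 'n) monoid" "\<lambda>v. \<phi> *v v"
  by (intro group_aut.intro group_Zd group_aut_axioms.intro GL_int_aut GL)

lemma S_carrier [simp]: "carrier S = UNIV"
  by (simp add: Zd_by_Z_def) (simp add: Zd_def)

lemma S_one: "\<one>\<^bsub>S\<^esub> = (0, 0)"
  by (simp add: Zd_by_Z_def) (simp add: Zd_def)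

lemma S_mult [simp]: "(v, k) \<otimes>\<^bsub>S\<^esub> (w, l) = (v + mpow \<phi> k *v w, k + l)"
  by (simp add: Zd_by_Z_def aut_pow) (simp add: Zd_def)

lemma S_inv [simp]: "inv\<^bsub>S\<^esub> (v, k) = (- (mpow \<phi> (- k) *v v), - k)"
  by (rule S.inv_equality) (simp_all add: S_one)

lemmas mv_simps = matrix_vector_right_distrib matrix_vector_mult_diff_distrib
  matrix_vector_mult_diff_rdistrib matrix_vector_mult_minus_right matrix_vector_mult_minus_left

section \<open>Bracket calculus and the invariant of a pair\<close>

lemma bracket_0 [simp]: "bracket \<phi> 0 v = 0"
  by (simp add: bracket_def)

text \<open>The minus sign for negative \<open>k\<close> is what makes one recursion valid on all of
  \<int>: there, raising \<open>k\<close> removes the summand at \<open>k\<close> from a negated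
  sum.\<close>

lemma bracket_Suc: "bracket \<phi> (k + 1) v = bracket \<phi> k v + mpow \<phi> k *v v"
proof (cases "k \<ge> 0")
  case True
  then have "{0..<k + 1} = insert k {0..<k}" by auto
  then show ?thesis using True by (simp add: bracket_def add.commute)
next
  case False
  then have "{k..<0} = insert k {k + 1..<0}" by auto
  then show ?thesis using False by (auto simp: bracket_def)
qed

lemma bracket_1 [simp]: "bracket \<phi> 1 v = v"
  using bracket_Suc[of 0 v] by simp

text \<open>This is the crossed homomorphism law for \<open>k \<mapsto> [k] v\<close>; equivalently,
  \<open>[k] v\<close> is the first component of \<open>(v, 1)^k\<close>.\<close>

lemma bracket_add: "bracket \<phi> (k + l) v = bracket \<phi> k v + mpow \<phi> k *v bracket \<phi> l v"
proof (induction l rule: int_induct[where k = 0])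
  case (step1 i)
  then show ?case
    using bracket_Suc[of "k + i" v] by (simp add: bracket_Suc mv_simps add.assoc)
next
  case (step2 i)
  then show ?case
    using bracket_Suc[of "k + (i - 1)" v] bracket_Suc[of "i - 1" v]
    by (simp add: mv_simps algebra_simps)
qed simp

lemma bracket_uminus: "bracket \<phi> (- k) v = - (mpow \<phi> (- k) *v bracket \<phi> k v)"
  using bracket_add[of "- k" k v] by (simp add: eq_neg_iff_add_eq_0)

lemma bracket_plus: "bracket \<phi> k (v + w) = bracket \<phi> k v + bracket \<phi> k w"
  by (simp add: bracket_def mv_simps sum.distrib)

lemma bracket_neg: "bracket \<phi> k (- v) = - bracket \<phi> k v"
  using bracket_plus[of k v "- v"] bracket_plus[of k 0 0]
  by (simp add: eq_neg_iff_add_eq_0 add.commute)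

lemma bracket_mpow: "bracket \<phi> k (mpow \<phi> l *v v) = mpow \<phi> l *v bracket \<phi> k v"
proof -
  have "mpow \<phi> l *v (\<Sum>i\<in>I. mpow \<phi> i *v v) = (\<Sum>i\<in>I. mpow \<phi> i *v (mpow \<phi> l *v v))"
    if "finite I" for I
    using that by (induction) (simp_all add: mv_simps add.commute)
  then show ?thesis
    by (simp add: bracket_def mv_simps)
qed

lemma same_orbit_refl: "same_orbit \<phi> u u"
  unfolding same_orbit_def by (rule exI[of _ 0]) simp

lemma same_orbit_trans: "same_orbit \<phi> u v \<Longrightarrow> same_orbit \<phi> v w \<Longrightarrow> same_orbit \<phi> u w"
  unfolding same_orbit_def by (elim exE disjE; simp add: mv_simps) blast+

text \<open>A swap negates the quotient. Inverting an entry with exponent \<open>k\<close>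
  multiplies it by \<open>- \<phi>^(-k)\<close>, by \<open>bracket_uminus\<close>. A multiplication
  leaves it unchanged, because the extra terms cancel by \<open>bracket_add\<close>.\<close>

lemma comm_quotient_step:
  assumes "nielsen_step S xs ys" "length xs = 2"
  shows "same_orbit \<phi> (comm_quotient \<phi> xs) (comm_quotient \<phi> ys)"
proof -
  obtain v k w l where xs: "xs = [(v, k), (w, l)]"
    using assms(2) by (auto simp: length_Suc_conv numeral_2_eq_2)
  have pos: "same_orbit \<phi> u u'" if "u' = mpow \<phi> i *v u" for u u' i
    using that unfolding same_orbit_def by blast
  have neg: "same_orbit \<phi> u u'" if "u' = - (mpow \<phi> i *v u)" for u u' i
    using that unfolding same_orbit_def by blast
  have "nielsen_step S [(v, k), (w, l)] ys"
    using assms(1) xs by simp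
  then show ?thesis
  proof (cases rule: nielsen_step_pair_cases)
    case 1
    then show ?thesis by (simp add: xs same_orbit_refl)
  next
    case 2
    then show ?thesis by (intro neg[of _ 0]) (simp add: xs)
  next
    case 3
    then show ?thesis
      by (intro neg[of _ "- k"])
        (simp add: xs bracket_uminus bracket_neg bracket_mpow mv_simps)
  next
    case 4
    then show ?thesis
      by (intro neg[of _ "- l"])
        (simp add: xs bracket_uminus bracket_neg bracket_mpow mv_simps)
  next
    case 5
    then show ?thesis
      by (intro pos[of _ 0])
        (simp add: xs bracket_plus bracket_mpow bracket_add)
  next
    case 6
    then show ?thesis
      by (intro pos[of _ 0])
        (simp add: xs bracket_plus bracket_mpow bracket_add)
  qed
qed

lemma comm_quotient_invariant:
  assumes "N xs ys" "length xs = 2"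
  shows "same_orbit \<phi> (comm_quotient \<phi> xs) (comm_quotient \<phi> ys) \<and> length ys = 2"
  using assms
proof (induction rule: rtranclp_induct)
  case base
  then show ?case by (simp add: same_orbit_refl)
next
  case (step ys zs)
  have "length zs = 2"
    using step.hyps(2) step.IH[OF step.prems] by cases (auto dest: mset_eq_length)
  then show ?case
    using step.IH[OF step.prems] comm_quotient_step[OF step.hyps(2)] same_orbit_trans by blast
qed

section \<open>Cyclic vectors and the centralizer\<close>

lemma commute_mpow:
  assumes "\<phi> ** M = M ** \<phi>"
  shows "mpow \<phi> k ** M = M ** mpow \<phi> k"
proof (induction k rule: int_induct[where k = 0])
  case (step1 i)
  then show ?case
    by (metis assms matrix_mul_assoc mpow_1 mpow_add)
next
  case (step2 i)
  have 1: "\<phi> ** mpow \<phi> (i - 1) = mpow \<phi> i" "mpow \<phi> (i - 1) ** \<phi> = mpow \<phi> i"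
    using mpow_add[of 1 "i - 1"] mpow_add[of "i - 1" 1] by simp_all
  have inv: "mpow \<phi> (- 1) ** \<phi> = mat 1"
    using mpow_add[of "- 1" 1] by simp
  \<comment> \<open>The claim is checked after multiplying by \<phi> on the left, which
    \<open>inv\<close> then cancels.\<close>
  have "\<phi> ** (mpow \<phi> (i - 1) ** M) = \<phi> ** (M ** mpow \<phi> (i - 1))"
    using step2.IH 1 assms by (metis matrix_mul_assoc)
  then show ?case
    by (metis inv matrix_mul_assoc matrix_mul_lid)
qed simp

lemma commute_laurent:
  assumes "P \<in> laurent \<phi>" "\<phi> ** M = M ** \<phi>"
  shows "P ** M = M ** P"
  using assms(1)
proof induction
  case (pow P k)
  then show ?case
    using commute_mpow[OF assms(2), of k] by (metis matrix_mul_assoc)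
next
  case (diff P Q)
  then show ?case
    by (simp add: matrix_eq matrix_vector_mul_assoc[symmetric] mv_simps)
qed simp

lemma laurent_commute_\<phi>: "P \<in> laurent \<phi> \<Longrightarrow> \<phi> ** P = P ** \<phi>"
  using commute_laurent[of P \<phi>] by simp

text \<open>A matrix commuting with \<phi> is linear over
  \<open>\<int>[\<phi>, \<phi>\<inverse>]\<close>, so its value on the module generator
  \<open>a\<close> determines it.\<close>

lemma cyclic_vector_inj:
  assumes a: "cyclic_vector \<phi> a" and AB: "\<phi> ** A = A ** \<phi>" "\<phi> ** B = B ** \<phi>"
    and eq: "A *v a = B *v a"
  shows "A = B"
proof -
  have "A *v v = B *v v" for v
  proof -
    obtain P where P: "P \<in> laurent \<phi>" "v = P *v a"
      using a by (auto simp: cyclic_vector_def)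
    then show ?thesis
      using commute_laurent[OF P(1) AB(1)] commute_laurent[OF P(1) AB(2)] eq
      by (metis matrix_vector_mul_assoc)
  qed
  then show ?thesis by (simp add: matrix_eq)
qed

lemma centralizer_iff: "M \<in> centralizer GL_int \<phi> \<longleftrightarrow> invertible M \<and> \<phi> ** M = M ** \<phi>"
  by (simp add: centralizer_def GL_int_def)

text \<open>Laurent polynomials \<open>P\<close> and \<open>Q\<close> carry \<open>a\<close> to
  \<open>b\<close> and \<open>b\<close> to \<open>a\<close>. Their products fix \<open>b\<close> and
  \<open>a\<close> respectively, so \<open>cyclic_vector_inj\<close> makes them mutually inverse,
  and \<open>P\<close> is the required matrix.\<close>

lemma centralizer_transitive:
  assumes a: "cyclic_vector \<phi> a" and b: "cyclic_vector \<phi> b"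
  shows "\<exists>M \<in> centralizer GL_int \<phi>. M *v a = b"
proof -
  obtain P where P: "P \<in> laurent \<phi>" "b = P *v a"
    using a by (auto simp: cyclic_vector_def)
  obtain Q where Q: "Q \<in> laurent \<phi>" "a = Q *v b"
    using b by (auto simp: cyclic_vector_def)
  note PQ = laurent_commute_\<phi>[OF P(1)] laurent_commute_\<phi>[OF Q(1)]
  have "\<phi> ** (P ** Q) = (P ** Q) ** \<phi>" "\<phi> ** (Q ** P) = (Q ** P) ** \<phi>"
    using PQ by (metis matrix_mul_assoc)+
  moreover have "(P ** Q) *v b = b" "(Q ** P) *v a = a"
    using P Q by (simp_all flip: matrix_vector_mul_assoc)
  ultimately have "P ** Q = mat 1" "Q ** P = mat 1"
    using cyclic_vector_inj[OF b, of "P ** Q" "mat 1"] cyclic_vector_inj[OF a, of "Q ** P" "mat 1"]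
    by simp_all
  then have "P \<in> centralizer GL_int \<phi>"
    using PQ by (auto simp: centralizer_iff invertible_def)
  then show ?thesis
    using P(2) by blast
qed

text \<open>A module automorphism takes generators to generators: pull \<open>v\<close> back along
  \<open>M\<close>, express the result through \<open>a\<close>, and push forward.\<close>

lemma centralizer_cyclic_vector:
  assumes a: "cyclic_vector \<phi> a" and M: "M \<in> centralizer GL_int \<phi>"
  shows "cyclic_vector \<phi> (M *v a)"
  unfolding cyclic_vector_def
proof
  fix v
  obtain M' where M': "M ** M' = mat 1"
    using M by (auto simp: centralizer_iff invertible_def)
  obtain P where P: "P \<in> laurent \<phi>" "M' *v v = P *v a"
    using a by (metis cyclic_vector_def)
  have "v = M *v (M' *v v)"
    by (simp add: matrix_vector_mul_assoc M')
  also have "\<dots> = P *v (M *v a)"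
    using commute_laurent[OF P(1), of M] M P(2)
    by (simp add: centralizer_iff matrix_vector_mul_assoc)
  finally show "\<exists>P\<in>laurent \<phi>. v = P *v (M *v a)" using P(1) by blast
qed

section \<open>Generating pairs and cyclic vectors\<close>

lemma cyclic_vector_if_generates:
  assumes gen: "generate S {(a, 0), (b, 1)} = UNIV"
  shows "cyclic_vector \<phi> a"
proof -
  let ?R = "{P *v a | P. P \<in> laurent \<phi>}"
  \<comment> \<open>Since \<open>(b, 1)^k = ([k] b, k)\<close>, this is the set of products of an
    element of the submodule \<open>?R\<close> with a power of \<open>(b, 1)\<close>. It is a
    subgroup containing both generators, hence everything, and its elements with exponent 0 form
    \<open>?R\<close>.\<close>
  let ?H = "{(v, k). v - bracket \<phi> k b \<in> ?R}"
  have R_pow: "mpow \<phi> k *v v \<in> ?R" if "v \<in> ?R" for v k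
    using that by (auto simp: matrix_vector_mul_assoc intro: laurent.pow)
  have R_diff: "v - w \<in> ?R" if "v \<in> ?R" "w \<in> ?R" for v w
    using that by (auto simp flip: matrix_vector_mult_diff_rdistrib intro: laurent.diff)
  have R_0: "0 \<in> ?R"
    using laurent.diff[OF laurent.one laurent.one, of \<phi>] by force
  have R_neg: "- v \<in> ?R" if "v \<in> ?R" for v
    using R_diff[OF R_0 that] by simp
  have R_plus: "v + w \<in> ?R" if "v \<in> ?R" "w \<in> ?R" for v w
    using R_diff[OF that(1) R_neg[OF that(2)]] by simp
  have "subgroup ?H S"
  proof (rule S.subgroupI)
    have "(0, 0) \<in> ?H"
      using R_0 by simp
    then show "?H \<noteq> {}" by blast
  next
    fix x assume "x \<in> ?H"
    then obtain v k where x: "x = (v, k)" "v - bracket \<phi> k b \<in> ?R" by auto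
    have "- (mpow \<phi> (- k) *v v) - bracket \<phi> (- k) b = - (mpow \<phi> (- k) *v (v - bracket \<phi> k b))"
      by (simp add: bracket_uminus mv_simps)
    also have "\<dots> \<in> ?R"
      by (intro R_neg R_pow x)
    finally show "inv\<^bsub>S\<^esub> x \<in> ?H" by (simp add: x)
  next
    fix x y assume "x \<in> ?H" "y \<in> ?H"
    then obtain v k w l where xy: "x = (v, k)" "v - bracket \<phi> k b \<in> ?R"
      "y = (w, l)" "w - bracket \<phi> l b \<in> ?R" by (cases x, cases y) blast
    have "v + mpow \<phi> k *v w - bracket \<phi> (k + l) b =
      (v - bracket \<phi> k b) + mpow \<phi> k *v (w - bracket \<phi> l b)"
      by (simp add: bracket_add mv_simps)
    also have "\<dots> \<in> ?R"
      by (intro R_plus R_pow xy)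
    finally show "x \<otimes>\<^bsub>S\<^esub> y \<in> ?H" by (simp add: xy)
  qed simp
  moreover have "{(a, 0), (b, 1)} \<subseteq> ?H"
    using R_0 laurent.one[of \<phi>] by force
  ultimately have "?H = UNIV"
    using S.generate_subgroup_incl[of "{(a, 0), (b, 1)}" ?H] gen by blast
  then have "(v, 0) \<in> ?H" for v by blast
  then show ?thesis
    by (auto simp: cyclic_vector_def)
qed

lemma generates_if_cyclic_vector:
  assumes a: "cyclic_vector \<phi> a"
  shows "generate S {(a, 0), (0, 1)} = UNIV"
proof -
  let ?H = "generate S {(a, 0), (0, 1)}"
  have sub: "subgroup ?H S" by (rule S.generate_is_subgroup) simp
  have "(0, 1) \<in> ?H" by (rule generate.incl) simp
  moreover have "(0, 1) [^]\<^bsub>S\<^esub> k = (0, k)" for k :: int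
  proof -
    have one: "\<one>\<^bsub>Zd\<^esub> = (0 :: int ^ 'n)" "(0 :: int ^ 'n) \<in> carrier Zd"
      by (simp_all add: Zd_def)
    have "(0, 0) \<otimes>\<^bsub>S\<^esub> (0, 1) [^]\<^bsub>S\<^esub> k = (0, k)"
      using A.semidirect_Z_normal_form[OF one(2), of k] by (simp only: one(1) Zd_by_Z_def)
    then show ?thesis
      using S.l_one[of "(0, 1) [^]\<^bsub>S\<^esub> k"] by (simp add: S_one)
  qed
  ultimately have t: "(0, k) \<in> ?H" for k
    using S.subgroup_int_pow_closed[OF sub, of "(0, 1)" k] by simp
  have "(P *v a, 0) \<in> ?H" if "P \<in> laurent \<phi>" for P
    using that
  proof induction
    case one
    show ?case by (rule generate.incl) simp
  next
    case (pow P k)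
    \<comment> \<open>Conjugation by the \<open>k\<close>-th power of the stable letter acts on
      vectors as \<open>\<phi>^k\<close>.\<close>
    have "(0, k) \<otimes>\<^bsub>S\<^esub> (P *v a, 0) \<otimes>\<^bsub>S\<^esub> (0, - k) \<in> ?H"
      by (intro generate.eng t pow)
    then show ?case by (simp add: matrix_vector_mul_assoc)
  next
    case (diff P Q)
    have "(P *v a, 0) \<otimes>\<^bsub>S\<^esub> inv\<^bsub>S\<^esub> (Q *v a, 0) \<in> ?H"
      by (intro generate.eng diff subgroup.m_inv_closed[OF sub])
    then show ?case by (simp add: mv_simps)
  qed
  then have "(v, 0) \<in> ?H" for v
    using a by (metis cyclic_vector_def)
  then have "(v, 0) \<otimes>\<^bsub>S\<^esub> (0, k) \<in> ?H" for v k
    by (intro generate.eng t)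
  then show ?thesis by auto
qed

section \<open>Reduction of generating pairs by Nielsen moves\<close>

lemma N_sym: "N xs ys \<Longrightarrow> N ys xs"
  by (rule S.nielsen_steps_sym) simp_all

lemma N_neg: "N [(a, 0), (b, 1)] [(- a, 0), (b, 1)]"
  using nielsen_inv1[of S "(a, 0)" "(b, 1)"] by simp

lemma N_mpow: "N [(a, 0), (b, 1)] [(mpow \<phi> k *v a, 0), (b, 1)]"
proof -
  have inv: "N [(a, 0), (b, 1)] [(mpow \<phi> (- 1) *v a, 0), (b, 1)]" for a
  proof -
    \<comment> \<open>Right multiplications by \<open>?s\<close> with inversions in between
      conjugate \<open>x = (a, 0)\<close> to \<open>?s\<inverse> x ?s\<close>. The vector
      \<open>b\<close> cancels because vectors commute.\<close>
    let ?s = "(b, 1)"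
    let ?x1 = "(a, 0) \<otimes>\<^bsub>S\<^esub> ?s"
    let ?x2 = "inv\<^bsub>S\<^esub> ?x1"
    let ?x3 = "?x2 \<otimes>\<^bsub>S\<^esub> ?s"
    have "N [(a, 0), ?s] [inv\<^bsub>S\<^esub> ?x3, ?s]"
      by (meson nielsen_mult1 nielsen_inv1 rtranclp_trans)
    moreover have "inv\<^bsub>S\<^esub> ?x3 = (mpow \<phi> (- 1) *v a, 0)"
      by (simp add: mv_simps)
    ultimately show ?thesis by simp
  qed
  \<comment> \<open>Conjugation in the other direction comes from running the moves
    backwards.\<close>
  have fwd: "N [(a, 0), (b, 1)] [(mpow \<phi> 1 *v a, 0), (b, 1)]" for a
    using N_sym[OF inv[of "mpow \<phi> 1 *v a"]] mpow_mpow_apply[of "- 1" 1 a]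
    by (simp del: mpow_mpow_apply)
  show ?thesis
  proof (induction k rule: int_induct[where k = 0])
    case (step1 i)
    show ?case
      using rtranclp_trans[OF step1.IH fwd] by (simp add: add.commute del: mpow_1)
  next
    case (step2 i)
    show ?case
      using rtranclp_trans[OF step2.IH inv] by (simp add: add.commute)
  qed simp
qed

text \<open>The induction mirrors the rules of \<open>laurent\<close>. For a power, \<open>a\<close>
  is replaced by \<open>\<phi>^k a\<close>, the hypothesis is applied, and \<open>a\<close> is
  restored. For a difference, the moves adding \<open>Q a\<close> are reversed.\<close>

lemma N_laurent:
  assumes "P \<in> laurent \<phi>"
  shows "N [(a, 0), (b, 1)] [(a, 0), (b + P *v a, 1)]"
  using assms
proof (induction arbitrary: a b)
  case one
  \<comment> \<open>Multiplying \<open>(b, 1)\<close> on the right by a vector adds its image under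
    \<phi>; this choice compensates for the twist.\<close>
  let ?a = "mpow \<phi> (- 1) *v a"
  have "N [(?a, 0), (b, 1)] [(?a, 0), (b + a, 1)]"
    using nielsen_mult2[of S "(?a, 0)" "(b, 1)"] mpow_mpow_apply[of 1 "- 1" a]
    by (simp del: mpow_mpow_apply)
  from rtranclp_trans[OF rtranclp_trans[OF N_mpow this] N_sym[OF N_mpow]]
  show ?case by simp
next
  case (pow P k)
  have "P *v (mpow \<phi> k *v a) = (mpow \<phi> k ** P) *v a"
    by (simp only: matrix_vector_mul_assoc commute_mpow[OF laurent_commute_\<phi>[OF pow.hyps(1)]])
  with rtranclp_trans[OF rtranclp_trans[OF N_mpow pow.IH] N_sym[OF N_mpow], of a b k]
  show ?case by simp
next
  case (diff P Q)
  have "N [(a, 0), (b + (P - Q) *v a, 1)] [(a, 0), (b + P *v a, 1)]"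
    using diff.IH(2)[of a "b + (P - Q) *v a"] by (simp add: mv_simps)
  from rtranclp_trans[OF diff.IH(1) N_sym[OF this]] show ?case .
qed

text \<open>Subtractive Euclidean algorithm on the exponents, with measure
  \<open>\<bar>k\<bar> + \<bar>l'\<bar>\<close>; the vector parts merely follow along.\<close>

lemma N_euclid: "\<exists>a b l. N [(v, k), (w, l')] [(a, 0), (b, l)] \<and> l \<ge> 0"
proof (induction "nat (\<bar>k\<bar> + \<bar>l'\<bar>)" arbitrary: v k w l' rule: less_induct)
  case less
  have posI: "\<exists>a b l. N xs [(a, 0), (b, l)] \<and> l \<ge> 0" if "N xs [(a, 0), (b, l)]" for xs a b l
  proof (cases "l \<ge> 0")
    case False
    then have "N xs [(a, 0), inv\<^bsub>S\<^esub> (b, l)]"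
      using that nielsen_inv2 rtranclp_trans by metis
    with False show ?thesis
      by (metis S_inv linear neg_0_le_iff_le)
  qed (use that in blast)
  have abs: "\<exists>v'. N [(v, k), y] [(v', \<bar>k\<bar>), y]" for v k y
    using nielsen_inv1[of S "(v, k)" y] by (cases "k \<ge> 0") auto
  have sub: "\<exists>v'. N [(v, k), (w, l)] [(v', k - l), (w, l)]" for v k w l
  proof -
    \<comment> \<open>Division by the second entry: invert it, multiply, then invert it
      back.\<close>
    have "N [(v, k), (w, l)] [(v, k) \<otimes>\<^bsub>S\<^esub> inv\<^bsub>S\<^esub> (w, l), inv\<^bsub>S\<^esub> (w, l)]"
      by (meson nielsen_inv2 nielsen_mult1 rtranclp_trans)
    then have "N [(v, k), (w, l)] [(v, k) \<otimes>\<^bsub>S\<^esub> inv\<^bsub>S\<^esub> (w, l), inv\<^bsub>S\<^esub> (inv\<^bsub>S\<^esub> (w, l))]"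
      by (meson nielsen_inv2 rtranclp_trans)
    then show ?thesis by (auto simp: mv_simps)
  qed
  obtain v1 where v1: "N [(v, k), (w, l')] [(v1, \<bar>k\<bar>), (w, l')]"
    using abs by blast
  obtain w1 where w1: "N [(w, l'), (v1, \<bar>k\<bar>)] [(w1, \<bar>l'\<bar>), (v1, \<bar>k\<bar>)]"
    using abs by blast
  \<comment> \<open>Both orders are recorded, since \<open>sub\<close> acts on the first entry and
    the larger exponent has to stand there.\<close>
  have sw: "N [(v, k), (w, l')] [(w1, \<bar>l'\<bar>), (v1, \<bar>k\<bar>)]"
    using v1 w1 nielsen_swap rtranclp_trans by metis
  then have ns: "N [(v, k), (w, l')] [(v1, \<bar>k\<bar>), (w1, \<bar>l'\<bar>)]"
    using nielsen_swap rtranclp_trans by metis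
  consider "k = 0" | "l' = 0" | "k \<noteq> 0" "l' \<noteq> 0" "\<bar>k\<bar> \<le> \<bar>l'\<bar>" | "k \<noteq> 0" "l' \<noteq> 0" "\<bar>l'\<bar> < \<bar>k\<bar>"
    by linarith
  then show ?case
  proof cases
    case 1
    then show ?thesis using ns by (intro posI) simp
  next
    case 2
    then show ?thesis using sw by (intro posI) simp
  next
    case 3
    obtain v' where v': "N [(w1, \<bar>l'\<bar>), (v1, \<bar>k\<bar>)] [(v', \<bar>l'\<bar> - \<bar>k\<bar>), (v1, \<bar>k\<bar>)]"
      using sub by blast
    have "nat (\<bar>\<bar>l'\<bar> - \<bar>k\<bar>\<bar> + \<bar>\<bar>k\<bar>\<bar>) < nat (\<bar>k\<bar> + \<bar>l'\<bar>)"
      using 3 by simp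
    from less[OF this, of v' v1] obtain a b m where
      "N [(v', \<bar>l'\<bar> - \<bar>k\<bar>), (v1, \<bar>k\<bar>)] [(a, 0), (b, m)]" "m \<ge> 0"
      by blast
    then show ?thesis
      using rtranclp_trans[OF sw rtranclp_trans[OF v']] by blast
  next
    case 4
    obtain v' where v': "N [(v1, \<bar>k\<bar>), (w1, \<bar>l'\<bar>)] [(v', \<bar>k\<bar> - \<bar>l'\<bar>), (w1, \<bar>l'\<bar>)]"
      using sub by blast
    have "nat (\<bar>\<bar>k\<bar> - \<bar>l'\<bar>\<bar> + \<bar>\<bar>l'\<bar>\<bar>) < nat (\<bar>k\<bar> + \<bar>l'\<bar>)"
      using 4 by simp
    from less[OF this, of v' w1] obtain a b m where
      "N [(v', \<bar>k\<bar> - \<bar>l'\<bar>), (w1, \<bar>l'\<bar>)] [(a, 0), (b, m)]" "m \<ge> 0"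
      by blast
    then show ?thesis
      using rtranclp_trans[OF ns rtranclp_trans[OF v']] by blast
  qed
qed

text \<open>After the Euclidean reduction, generation forces \<open>l = 1\<close> and makes
  \<open>a\<close> cyclic. Then \<open>- b\<close> is a Laurent multiple of \<open>a\<close>, so
  \<open>N_laurent\<close> removes \<open>b\<close>.\<close>

lemma generating_pair_normal_form:
  assumes "xs \<in> generating_tuples S 2"
  shows "\<exists>a. cyclic_vector \<phi> a \<and> N xs [(a, 0), (0, 1)]"
proof -
  have len: "length xs = 2" and gen: "generate S (set xs) = UNIV"
    using assms by (simp_all add: generating_tuples_def)
  obtain v k w l' where "xs = [(v, k), (w, l')]"
    using len by (auto simp: length_Suc_conv numeral_2_eq_2)
  then obtain a b l where N: "N xs [(a, 0), (b, l)]" and l: "l \<ge> 0"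
    using N_euclid by metis
  have gen': "generate S {(a, 0), (b, l)} = UNIV"
    using S.nielsen_steps_generate_eq[OF N] gen by simp
  \<comment> \<open>This subgroup contains both generators, so \<open>l\<close> divides the exponent
    1 of the stable letter.\<close>
  have "subgroup {x. l dvd snd x} S"
    by (rule S.subgroupI) auto
  from S.generate_subgroup_incl[OF _ this, of "{(a, 0), (b, l)}"] gen'
  have "UNIV \<subseteq> {x :: (int ^ 'n) \<times> int. l dvd snd x}" by simp
  then have "(0, 1) \<in> {x :: (int ^ 'n) \<times> int. l dvd snd x}" by blast
  then have "l = 1" using l by simp
  then have cyc: "cyclic_vector \<phi> a"
    using cyclic_vector_if_generates gen' by simp
  then obtain P where "P \<in> laurent \<phi>" "- b = P *v a"
    by (metis cyclic_vector_def)
  then have "N [(a, 0), (b, 1)] [(a, 0), (0, 1)]"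
    using N_laurent[of P a b] by (metis add.right_inverse)
  then show ?thesis
    using N cyc \<open>l = 1\<close> rtranclp_trans by metis
qed

section \<open>Nielsen classes as orbits of cyclic vectors\<close>

lemma N_iff_same_orbit:
  "N [(a, 0), (0, 1)] [(b, 0), (0, 1)] \<longleftrightarrow> same_orbit \<phi> a b"
proof
  assume "N [(a, 0), (0, 1)] [(b, 0), (0, 1)]"
  \<comment> \<open>On a pair \<open>(a, 0), (0, 1)\<close> the invariant is
    \<open>[1] a - [0] 0 = a\<close>.\<close>
  from comm_quotient_invariant[OF this] show "same_orbit \<phi> a b" by simp
next
  assume "same_orbit \<phi> a b"
  then obtain k where "b = mpow \<phi> k *v a \<or> b = - (mpow \<phi> k *v a)"
    by (auto simp: same_orbit_def)
  then show "N [(a, 0), (0, 1)] [(b, 0), (0, 1)]"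
    using N_mpow[of a 0 k] rtranclp_trans[OF N_mpow[of a 0 k] N_neg] by auto
qed

definition pair_class :: "int ^ 'n \<Rightarrow> ((int ^ 'n) \<times> int) list set" where
  "pair_class a = nielsen_equiv S 2 `` {[(a, 0), (0, 1)]}"

lemma cyclic_pair_generating:
  "cyclic_vector \<phi> a \<Longrightarrow> [(a, 0), (0, 1)] \<in> generating_tuples S 2"
  by (simp add: generating_tuples_def generates_if_cyclic_vector)

lemma pair_class_eq_iff:
  assumes "cyclic_vector \<phi> a" "cyclic_vector \<phi> b"
  shows "pair_class a = pair_class b \<longleftrightarrow> same_orbit \<phi> a b"
  using eq_equiv_class_iff[OF equiv_nielsen[OF S.is_group]
      cyclic_pair_generating[OF assms(1)] cyclic_pair_generating[OF assms(2)]]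
    cyclic_pair_generating[OF assms(1)] cyclic_pair_generating[OF assms(2)]
  by (simp add: pair_class_def nielsen_equiv_def N_iff_same_orbit)

lemma nielsen_classes_eq: "nielsen_classes S 2 = pair_class ` {a. cyclic_vector \<phi> a}"
proof
  show "pair_class ` {a. cyclic_vector \<phi> a} \<subseteq> nielsen_classes S 2"
    by (auto simp: nielsen_classes_def pair_class_def intro: quotientI cyclic_pair_generating)
  show "nielsen_classes S 2 \<subseteq> pair_class ` {a. cyclic_vector \<phi> a}"
  proof
    fix X assume "X \<in> nielsen_classes S 2"
    then obtain xs where xs: "xs \<in> generating_tuples S 2" "X = nielsen_equiv S 2 `` {xs}"
      by (auto simp: nielsen_classes_def elim: quotientE)
    obtain a where a: "cyclic_vector \<phi> a" "N xs [(a, 0), (0, 1)]"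
      using generating_pair_normal_form[OF xs(1)] by blast
    then have "(xs, [(a, 0), (0, 1)]) \<in> nielsen_equiv S 2"
      using xs(1) cyclic_pair_generating by (simp add: nielsen_equiv_def)
    then have "X = pair_class a"
      using equiv_class_eq[OF equiv_nielsen[OF S.is_group]] xs(2) by (simp add: pair_class_def)
    then show "X \<in> pair_class ` {a. cyclic_vector \<phi> a}" using a by blast
  qed
qed

section \<open>From orbits of cyclic vectors to cosets in the centralizer\<close>

lemma cyclic_vectors_eq:
  assumes "cyclic_vector \<phi> a"
  shows "{b. cyclic_vector \<phi> b} = (\<lambda>M. M *v a) ` centralizer GL_int \<phi>"
  using centralizer_transitive[OF assms] centralizer_cyclic_vector[OF assms] by blast

text \<open>All matrices involved commute with \<phi>, so by \<open>cyclic_vector_inj\<close>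
  equations between them can be tested on \<open>a\<close>.\<close>

lemma same_orbit_centralizer_iff:
  assumes a: "cyclic_vector \<phi> a"
    and M: "M \<in> centralizer GL_int \<phi>" and M': "M' \<in> centralizer GL_int \<phi>"
  shows "same_orbit \<phi> (M *v a) (M' *v a) \<longleftrightarrow> (\<exists>k. M' = mpow \<phi> k ** M \<or> M' = - (mpow \<phi> k ** M))"
proof -
  have c: "\<phi> ** (mpow \<phi> k ** M) = (mpow \<phi> k ** M) ** \<phi>" for k
    using M commute_mpow[of \<phi> k] by (metis centralizer_iff matrix_mul_assoc)
  have c': "\<phi> ** (- (mpow \<phi> k ** M)) = (- (mpow \<phi> k ** M)) ** \<phi>" for k
    using c[of k]
    by (simp add: matrix_eq mv_simps flip: matrix_vector_mul_assoc)
  have "\<phi> ** M' = M' ** \<phi>" using M' by (simp add: centralizer_iff)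
  then have "M' = mpow \<phi> k ** M \<longleftrightarrow> M' *v a = mpow \<phi> k *v (M *v a)"
    "M' = - (mpow \<phi> k ** M) \<longleftrightarrow> M' *v a = - (mpow \<phi> k *v (M *v a))" for k
    using cyclic_vector_inj[OF a _ c, of M' k] cyclic_vector_inj[OF a _ c', of M' k]
    by (auto simp: matrix_vector_mul_assoc mv_simps)
  then show ?thesis
    unfolding same_orbit_def by simp
qed

definition coset :: "int ^ 'n ^ 'n \<Rightarrow> (int ^ 'n ^ 'n) set" where
  "coset M = range (\<lambda>k. mpow \<phi> k ** M)"

lemma coset_eq_iff: "coset M = coset M' \<longleftrightarrow> (\<exists>k. M' = mpow \<phi> k ** M)"
proof
  assume "coset M = coset M'"
  moreover have "M' \<in> coset M'"
    unfolding coset_def by (rule range_eqI[of _ _ 0]) simp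
  ultimately show "\<exists>k. M' = mpow \<phi> k ** M" by (auto simp: coset_def)
next
  assume "\<exists>k. M' = mpow \<phi> k ** M"
  then obtain k where k: "M' = mpow \<phi> k ** M" by blast
  have "mpow \<phi> l ** M = mpow \<phi> (l - k) ** M'" "mpow \<phi> l ** M' = mpow \<phi> (l + k) ** M" for l
    using mpow_add[of "l - k" k] mpow_add[of l k] by (simp_all add: k matrix_mul_assoc)
  then show "coset M = coset M'" unfolding coset_def by blast
qed

lemma rcosets_eq:
  "rcosets\<^bsub>GL_int\<lparr>carrier := centralizer GL_int \<phi>\<rparr>\<^esub> (generate GL_int {\<phi>}) =
    coset ` centralizer GL_int \<phi>"
  by (auto simp: RCOSETS_def r_coset_def coset_def L.generate_pow[OF GL] GL_mult)

text \<open>By transitivity the classes are the values of \<open>?f\<close> on the centralizer. This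
  map is constant on cosets of \<open>\<langle>\<phi>\<rangle>\<close>, and each fibre meets at most
  the two cosets of \<open>M\<close> and \<open>- M\<close>.\<close>

lemma finite_iff:
  assumes a: "cyclic_vector \<phi> a"
  shows "finite (pair_class ` {b. cyclic_vector \<phi> b}) \<longleftrightarrow> finite (coset ` centralizer GL_int \<phi>)"
proof -
  let ?C = "centralizer GL_int \<phi>"
  let ?f = "\<lambda>M. pair_class (M *v a)"
  have f_eq: "?f M = ?f M' \<longleftrightarrow> coset M = coset M' \<or> coset (- M) = coset M'"
    if "M \<in> ?C" "M' \<in> ?C" for M M'
  proof -
    have "mpow \<phi> k ** (- M) = - (mpow \<phi> k ** M)" for k
      by (simp add: matrix_eq mv_simps flip: matrix_vector_mul_assoc)
    then show ?thesis
      using that centralizer_cyclic_vector[OF a]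
      by (auto simp: pair_class_eq_iff same_orbit_centralizer_iff[OF a] coset_eq_iff)
  qed
  have "finite (?f ` ?C) \<longleftrightarrow> finite (coset ` ?C)"
  proof
    assume "finite (coset ` ?C)"
    \<comment> \<open>As \<open>?f\<close> depends only on the coset, it can be evaluated at a
      chosen representative.\<close>
    moreover have "?f ` ?C \<subseteq> (\<lambda>X. ?f (SOME M. M \<in> ?C \<and> coset M = X)) ` coset ` ?C"
    proof
      fix Y assume "Y \<in> ?f ` ?C"
      then obtain M where M: "M \<in> ?C" "Y = ?f M" by blast
      let ?M = "SOME M'. M' \<in> ?C \<and> coset M' = coset M"
      have "?M \<in> ?C \<and> coset ?M = coset M"
        by (rule someI[of _ M]) (use M in simp)
      then have "?f ?M = ?f M" using f_eq M(1) by blast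
      then show "Y \<in> (\<lambda>X. ?f (SOME M. M \<in> ?C \<and> coset M = X)) ` coset ` ?C"
        using M by blast
    qed
    ultimately show "finite (?f ` ?C)" by (meson finite_imageI finite_subset)
  next
    assume fin: "finite (?f ` ?C)"
    \<comment> \<open>\<open>g\<close> picks one matrix per class; every other matrix of that class
      lies in the coset of \<open>g Y\<close> or of \<open>- g Y\<close>.\<close>
    define g where "g Y = (SOME M. M \<in> ?C \<and> ?f M = Y)" for Y
    have "coset ` ?C \<subseteq> (\<Union>Y\<in>?f ` ?C. {coset (g Y), coset (- g Y)})"
    proof
      fix X assume "X \<in> coset ` ?C"
      then obtain M where M: "M \<in> ?C" "X = coset M" by blast
      have "g (?f M) \<in> ?C \<and> ?f (g (?f M)) = ?f M"
        unfolding g_def by (rule someI[of _ M]) (use M in simp)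
      then have "X \<in> {coset (g (?f M)), coset (- g (?f M))}"
        using f_eq M by blast
      then show "X \<in> (\<Union>Y\<in>?f ` ?C. {coset (g Y), coset (- g Y)})" using M by blast
    qed
    moreover have "finite (\<Union>Y\<in>?f ` ?C. {coset (g Y), coset (- g Y)})"
      using fin by blast
    ultimately show "finite (coset ` ?C)" by (rule finite_subset)
  qed
  then show ?thesis
    by (simp add: cyclic_vectors_eq[OF a] image_image)
qed

end

theorem theorem1p2:
  fixes \<phi> :: "int ^ 'n ^ 'n"
  assumes "\<phi> \<in> carrier GL_int"
    and "has_rank (Zd_by_Z \<phi>) 2"
  shows "infinite (nielsen_classes (Zd_by_Z \<phi>) 2) \<longleftrightarrow>
    infinite_index GL_int (centralizer GL_int \<phi>) (generate GL_int {\<phi>})"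
proof -
  interpret GL_int_elem \<phi> by unfold_locales (rule assms(1))
  \<comment> \<open>The rank hypothesis supplies a generating pair, and its normal form yields the
    cyclic vector that serves as base point for \<open>finite_iff\<close>.\<close>
  obtain X where X: "generate (Zd_by_Z \<phi>) X = carrier (Zd_by_Z \<phi>)" "card X = 2"
    using assms(2) by (auto simp: has_rank_def)
  then obtain x y where "X = {x, y}" by (auto simp: card_2_iff)
  then have "[x, y] \<in> generating_tuples (Zd_by_Z \<phi>) 2"
    using X by (simp add: generating_tuples_def)
  then obtain a where "cyclic_vector \<phi> a"
    using generating_pair_normal_form by blast
  then show ?thesis
    by (simp add: nielsen_classes_eq infinite_index_def rcosets_eq finite_iff)
qed

end
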